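(* Consider the scalar equation $\dot{x}(t)+\sum_{k=1}^m a_k(t)x(h_k(t))=0$. Suppose $a_k(t)\ge 0$ for $k=1,\dots,m$, $$\limsup_{t\to\infty}\int_{\min_k\{h_k(t)\}}^t\sum_{i=1}^m a_i(s)\,ds<1+\frac1e \qquad\text{and}\qquad \int_0^\infty\sum_{k=1}^m a_k(t)\,dt=\infty.$$ Then the equation is asymptotically stable. If in addition there exists $R>0$ such that $\liminf_{t\to\infty}\int_t^{t+R}\sum_{k=1}^m a_k(\tau)\,d\tau>0$, then the fundamental function of the equation has an exponential estimation. If moreover also $\limsup_{t\to\infty}(t-h_k(t))<\infty$ for $k=1,\dots,m$, then the equation is exponentially stable.
   Context: Standing assumptions: $a_k:[0,\infty)\to\mathbb{R}$ are Lebesgue measurable and essentially bounded; $h_k:[0,\infty)\to\mathbb{R}$ are Lebesgue measurable, $h_k(t)\le t$, $\lim_{t\to\infty}h_k(t)=\infty$ (so $h_k(t)\ge 0$ for large $t$ and the integrals in the limit conditions make sense). For any $t_0\ge 0$, $x_0\in\mathbb{R}$ and any bounded Borel measurable $\varphi:(-\infty,t_0)\to\mathbb{R}$, the solution of the equation with initial conditions $x(t)=\varphi(t)$ for $t<t_0$, $x(t_0)=x_0$ is the function satisfying these conditions which is locally absolutely continuous on $[t_0,\infty)$ and satisfies the equation for almost all $t\ge t_0$. The fundamental function $X(t,s)$ is, for each $s\ge0$, the solution on $t\ge s$ with $X(t,s)=0$ for $t<s$ and $X(s,s)=1$. It has an exponential estimation if there are $K>0,\lambda>0$ with $|X(t,s)|\le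 Ke^{-\lambda(t-s)}$ for all $t\ge s\ge 0$. The equation is stable if for every $t_0\ge0$ and $\varepsilon>0$ there is $\delta>0$ such that $\sup_{t<t_0}|\varphi(t)|+|x(t_0)|<\delta$ implies $|x(t)|<\varepsilon$ for $t\ge t_0$. It is asymptotically stable if it is stable and, for every $t_0\ge0$, all solutions tend to zero as $t\to\infty$. It is exponentially stable if there are $M>0,\mu>0$, independent of $t_0$ and of the initial data, such that every solution satisfies $|x(t)|\le Me^{-\mu(t-t_0)}\left(|x(t_0)|+\sup_{t<t_0}|\varphi(t)|\right)$ for $t\ge t_0$. *)

theory Defs
  imports "HOL-Analysis.Analysis"
begin

text \<open>
  The delay equation \<open>x'(t) + (\<Sum>k=1..m. a k t * x (h k t)) = 0\<close> on \<open>[0,\<infinity>)\<close> is given by \<open>m\<close>, the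
  coefficients \<open>a\<close> and the delayed arguments \<open>h\<close>. The values of \<open>a k\<close> and \<open>h k\<close> matter only on
  \<open>{0..}\<close> and for \<open>k \<in> {1..m}\<close>.
\<close>

text \<open>
  This is absolute continuity of functions; the library constant \<open>absolutely_continuous\<close> is the
  relation between measures.
\<close>

definition abs_continuous_on_interval :: "(real \<Rightarrow> real) \<Rightarrow> real \<Rightarrow> real \<Rightarrow> bool" where
  "abs_continuous_on_interval f c d \<longleftrightarrow>
     (\<forall>\<epsilon>>0. \<exists>\<delta>>0. \<forall>(n::nat) (u::nat \<Rightarrow> real) (v::nat \<Rightarrow> real).
        (\<forall>i<n. c \<le> u i \<and> u i \<le> v i \<and> v i \<le> d) \<longrightarrow>
        (\<forall>i<n. \<forall>j<n. i \<noteq> j \<longrightarrow> {u i<..<v i} \<inter> {u j<..<v j} = {}) \<longrightarrow>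
        (\<Sum>i<n. v i - u i) < \<delta> \<longrightarrow>
        (\<Sum>i<n. \<bar>f (v i) - f (u i)\<bar>) < \<epsilon>)"

definition locally_abs_continuous_from :: "(real \<Rightarrow> real) \<Rightarrow> real \<Rightarrow> bool" where
  "locally_abs_continuous_from f t0 \<longleftrightarrow>
     (\<forall>c d. t0 \<le> c \<longrightarrow> c \<le> d \<longrightarrow> abs_continuous_on_interval f c d)"

definition initial_function :: "real \<Rightarrow> (real \<Rightarrow> real) \<Rightarrow> bool" where
  "initial_function t0 \<phi> \<longleftrightarrow>
     \<phi> \<in> borel_measurable (restrict_space borel {..<t0}) \<and> bounded (\<phi> ` {..<t0})"

definition initial_sup :: "real \<Rightarrow> (real \<Rightarrow> real) \<Rightarrow> real" where
  "initial_sup t0 \<phi> = (SUP t\<in>{..<t0}. \<bar>\<phi> t\<bar>)"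

definition dde_solution ::
  "nat \<Rightarrow> (nat \<Rightarrow> real \<Rightarrow> real) \<Rightarrow> (nat \<Rightarrow> real \<Rightarrow> real) \<Rightarrow>
   real \<Rightarrow> (real \<Rightarrow> real) \<Rightarrow> real \<Rightarrow> (real \<Rightarrow> real) \<Rightarrow> bool" where
  "dde_solution m a h t0 \<phi> x0 x \<longleftrightarrow>
     (\<forall>t<t0. x t = \<phi> t) \<and> x t0 = x0 \<and>
     locally_abs_continuous_from x t0 \<and>
     (AE t in lebesgue_on {t0..}.
        \<exists>x'. (x has_real_derivative x') (at t) \<and> x' + (\<Sum>k=1..m. a k t * x (h k t)) = 0)"

text \<open>The first argument of \<open>X\<close> is the time \<open>t\<close>, the second the starting point \<open>s\<close>.\<close>

definition fundamental_function ::
  "nat \<Rightarrow> (nat \<Rightarrow> real \<Rightarrow> real) \<Rightarrow> (nat \<Rightarrow> real \<Rightarrow> real) \<Rightarrow> (real \<Rightarrow> real \<Rightarrow> real) \<Rightarrow> bool" where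
  "fundamental_function m a h X \<longleftrightarrow>
     (\<forall>s\<ge>0. dde_solution m a h s (\<lambda>_. 0) 1 (\<lambda>t. X t s))"

definition exponential_estimation :: "(real \<Rightarrow> real \<Rightarrow> real) \<Rightarrow> bool" where
  "exponential_estimation X \<longleftrightarrow>
     (\<exists>K>0. \<exists>\<nu>>0. \<forall>s\<ge>0. \<forall>t\<ge>s. \<bar>X t s\<bar> \<le> K * exp (- \<nu> * (t - s)))"

definition dde_stable ::
  "nat \<Rightarrow> (nat \<Rightarrow> real \<Rightarrow> real) \<Rightarrow> (nat \<Rightarrow> real \<Rightarrow> real) \<Rightarrow> bool" where
  "dde_stable m a h \<longleftrightarrow>
     (\<forall>t0\<ge>0. \<forall>\<epsilon>>0. \<exists>\<delta>>0. \<forall>\<phi> x0 x.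
        initial_function t0 \<phi> \<longrightarrow> dde_solution m a h t0 \<phi> x0 x \<longrightarrow>
        initial_sup t0 \<phi> + \<bar>x t0\<bar> < \<delta> \<longrightarrow> (\<forall>t\<ge>t0. \<bar>x t\<bar> < \<epsilon>))"

definition dde_asymptotically_stable ::
  "nat \<Rightarrow> (nat \<Rightarrow> real \<Rightarrow> real) \<Rightarrow> (nat \<Rightarrow> real \<Rightarrow> real) \<Rightarrow> bool" where
  "dde_asymptotically_stable m a h \<longleftrightarrow>
     dde_stable m a h \<and>
     (\<forall>t0\<ge>0. \<forall>\<phi> x0 x.
        initial_function t0 \<phi> \<longrightarrow> dde_solution m a h t0 \<phi> x0 x \<longrightarrow> (x \<longlongrightarrow> 0) at_top)"

definition dde_exponentially_stable ::
  "nat \<Rightarrow> (nat \<Rightarrow> real \<Rightarrow> real) \<Rightarrow> (nat \<Rightarrow> real \<Rightarrow> real) \<Rightarrow> bool" where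
  "dde_exponentially_stable m a h \<longleftrightarrow>
     (\<exists>M>0. \<exists>\<mu>>0. \<forall>t0\<ge>0. \<forall>\<phi> x0 x.
        initial_function t0 \<phi> \<longrightarrow> dde_solution m a h t0 \<phi> x0 x \<longrightarrow>
        (\<forall>t\<ge>t0. \<bar>x t\<bar> \<le> M * exp (- \<mu> * (t - t0)) * (\<bar>x t0\<bar> + initial_sup t0 \<phi>)))"

end

theory Submission
  imports Defs
begin

text \<open>
  Let \<open>A t = \<integral>\<^sub>0\<^sup>t \<Sum>\<^sub>k a\<^sub>k\<close> and measure time by \<open>A\<close>: the slope of \<open>x\<close> is then minus a weighted
  average of the delayed values \<open>x (h\<^sub>k t)\<close>, and eventually all delays are at most \<open>r = 1 + 1/e < 3/2\<close>.
  Let \<open>\<bar>x\<bar> \<le> V\<close> on a time span of length 7. If \<open>x\<close> has a zero \<open>u\<close> near its end, then the excursion of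
  \<open>x\<close> after \<open>u\<close> can only be driven by delayed values before \<open>u\<close>, which are at most \<open>V\<close> times their
  distance to \<open>u\<close>; this keeps the excursion below \<open>\<theta> V\<close> with \<open>\<theta> < 1\<close>. If \<open>x\<close> has no zero there,
  it is eventually monotone and at least halves. Hence \<open>\<bar>x\<bar>\<close> shrinks by the factor \<open>\<theta>\<close> per time span 7,
  that is, exponentially in \<open>A\<close>, uniformly in \<open>t\<^sub>0\<close>. As \<open>A t \<longlonglongrightarrow> \<infinity>\<close> this gives asymptotic stability,
  and the lower integral bound makes \<open>A\<close> grow linearly, which gives both exponential estimates.
\<close>

subsection \<open>The fundamental theorem of calculus for absolutely continuous functions\<close>

text \<open>
  The gauge confines the intervals tagged in \<open>N\<close> to an open set of small measure, where absolute
  continuity makes the variation of \<open>f\<close> small.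
\<close>

lemma abs_continuous_has_integral:
  fixes f f' :: "real \<Rightarrow> real"
  assumes ac: "abs_continuous_on_interval f c d" and cd: "c \<le> d" and N: "negligible N"
    and deriv: "\<And>t. t \<in> {c..d} - N \<Longrightarrow> (f has_real_derivative f' t) (at t within {c..d})"
  shows "(f' has_integral (f d - f c)) {c..d}"
proof -
  \<comment> \<open>Tags in \<open>N\<close> get the value 0, so that there only the increments of
    \<open>f\<close> remain in the Riemann sum.\<close>
  define g where "g t = (if t \<in> N then 0 else f' t)" for t
  have "(g has_integral (f d - f c)) {c..d}"
    unfolding has_integral_real
  proof (intro allI impI)
    fix e :: real assume e: "0 < e"
    have "0 < e / 2" using e by simp
    from ac[unfolded abs_continuous_on_interval_def, THEN spec, THEN mp, OF this]
    obtain \<delta> where \<delta>: "\<delta> > 0" and small: "\<forall>(n::nat) u v.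
        (\<forall>i<n. c \<le> u i \<and> u i \<le> v i \<and> v i \<le> d) \<longrightarrow>
        (\<forall>i<n. \<forall>j<n. i \<noteq> j \<longrightarrow> {u i<..<v i} \<inter> {u j<..<v j} = {}) \<longrightarrow>
        (\<Sum>i<n. v i - u i) < \<delta> \<longrightarrow> (\<Sum>i<n. \<bar>f (v i) - f (u i)\<bar>) < e / 2"
      by (elim exE conjE)
    have Nnull: "N \<in> null_sets lebesgue" using N by (simp add: negligible_iff_null_sets)
    then obtain U where U: "open U" "N \<subseteq> U" "U - N \<in> lmeasurable" "emeasure lebesgue (U - N) < ennreal \<delta>"
      using sets_lebesgue_outer_open[of N \<delta>] \<delta> by (metis null_setsD2)
    have Us: "U \<in> sets lborel" using U(1) by simp
    \<comment> \<open>Since \<open>N\<close> is null, the whole of \<open>U\<close>, and not only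
      \<open>U - N\<close>, has measure below \<delta>.\<close>
    have "emeasure lborel U = emeasure lebesgue U" using Us by simp
    also have "\<dots> = emeasure lebesgue (U - N)"
      using Nnull U(1) by (simp add: emeasure_Diff_null_set)
    finally have Um: "emeasure lborel U < ennreal \<delta>" using U(4) by simp
    \<comment> \<open>This slack keeps the total linearization error, \<eta> times
      \<open>d - c\<close>, below \<open>e / 2\<close>; the added 1 covers
      \<open>c = d\<close>.\<close>
    define \<eta> where "\<eta> = e / (2 * (d - c + 1))"
    have \<eta>: "0 < \<eta>" using e cd by (simp add: \<eta>_def)
    have "\<exists>D>0. t \<in> {c..d} - N \<longrightarrow> (\<forall>y\<in>{c..d}. \<bar>y - t\<bar> < D \<longrightarrow> \<bar>f y - f t - (y - t) * f' t\<bar> \<le> \<eta> * \<bar>y - t\<bar>)" for t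
    proof (cases "t \<in> {c..d} - N")
      case True
      then have "(f has_derivative (\<lambda>h. f' t * h)) (at t within {c..d})"
        using deriv by (simp add: has_field_derivative_def)
      then show ?thesis using \<eta> unfolding has_derivative_within_alt
        by (force simp: mult.commute)
    qed (auto intro: exI[of _ 1])
    then obtain D where D: "\<And>t. D t > 0" "\<And>t y. \<lbrakk>t \<in> {c..d} - N; y \<in> {c..d}; \<bar>y - t\<bar> < D t\<rbrakk>
        \<Longrightarrow> \<bar>f y - f t - (y - t) * f' t\<bar> \<le> \<eta> * \<bar>y - t\<bar>" by metis
    define \<gamma> where "\<gamma> t = (if t \<in> N then U else ball t (D t))" for t
    have gauge: "gauge \<gamma>" using U D(1) by (auto simp: gauge_def \<gamma>_def)
    have main: "norm ((\<Sum>(x, K)\<in>p. measure lborel K *\<^sub>R g x) - (f d - f c)) < e"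
      if ptag: "p tagged_division_of {c..d}" and fine: "\<gamma> fine p" for p
    proof -
      define lo where "lo q = Inf (snd q)" for q :: "real \<times> real set"
      define hi where "hi q = Sup (snd q)" for q :: "real \<times> real set"
      have P: "snd q = {lo q..hi q} \<and> c \<le> lo q \<and> lo q \<le> fst q \<and> fst q \<le> hi q \<and> hi q \<le> d" if "q \<in> p" for q
      proof -
        obtain x K where q: "q = (x, K)" by force
        have "x \<in> K" "K \<subseteq> {c..d}" "\<exists>u v. K = cbox u v"
          using ptag that unfolding q by blast+
        then obtain u v where "K = {u..v}" "u \<le> x" "x \<le> v" "c \<le> u" "v \<le> d" by force
        then show ?thesis by (simp add: q lo_def hi_def)
      qed
      have fin: "finite p" using ptag by blast
      have disj: "{lo q<..<hi q} \<inter> {lo q'<..<hi q'} = {}" if "q \<in> p" "q' \<in> p" "q \<noteq> q'" for q q'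
      proof -
        have "interior (snd q) \<inter> interior (snd q') = {}"
          using tagged_division_ofD(5)[OF ptag, of "fst q" "snd q" "fst q'" "snd q'"] that by simp
        then show ?thesis using P[OF that(1)] P[OF that(2)] by (metis interior_atLeastAtMost_real)
      qed
      define pN where "pN = {q \<in> p. fst q \<in> N}"
      define pG where "pG = {q \<in> p. fst q \<notin> N}"
      have split: "p = pG \<union> pN" "pG \<inter> pN = {}" by (auto simp: pN_def pG_def)
      have finN: "finite pN" and finG: "finite pG" using fin by (auto simp: pN_def pG_def)
      define F where "F q = measure lborel (snd q) * g (fst q) - (f (hi q) - f (lo q))" for q
      have dc: "d - c = (\<Sum>q\<in>p. hi q - lo q)"
        using additive_tagged_division_1[OF cd ptag, of "\<lambda>x. x"]
        by (simp add: hi_def lo_def case_prod_unfold)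
      have fdc: "f d - f c = (\<Sum>q\<in>p. f (hi q) - f (lo q))"
        using additive_tagged_division_1[OF cd ptag, of f]
        by (simp add: hi_def lo_def case_prod_unfold)
      have "(\<Sum>(x, K)\<in>p. measure lborel K *\<^sub>R g x) - (f d - f c) = sum F p"
        by (simp add: fdc F_def sum_subtractf case_prod_unfold)
      also have "\<dots> = sum F pG + sum F pN" using split finN finG by (metis sum.union_disjoint)
      finally have eq: "(\<Sum>(x, K)\<in>p. measure lborel K *\<^sub>R g x) - (f d - f c) = sum F pG + sum F pN" .
      have "\<bar>sum F pG\<bar> \<le> (\<Sum>q\<in>pG. \<eta> * (hi q - lo q))"
      proof (rule order_trans[OF sum_abs sum_mono])
        fix q assume "q \<in> pG"
        then have q: "q \<in> p" "fst q \<notin> N" by (auto simp: pG_def)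
        note Pq = P[OF q(1)]
        have "snd q \<subseteq> ball (fst q) (D (fst q))"
          using fineD[OF fine, of "fst q" "snd q"] q by (simp add: \<gamma>_def)
        moreover have "lo q \<in> snd q" "hi q \<in> snd q" using Pq by auto
        ultimately have "lo q \<in> ball (fst q) (D (fst q))" "hi q \<in> ball (fst q) (D (fst q))"
          by blast+
        then have "\<bar>f (lo q) - f (fst q) - (lo q - fst q) * f' (fst q)\<bar> \<le> \<eta> * \<bar>lo q - fst q\<bar>"
          and "\<bar>f (hi q) - f (fst q) - (hi q - fst q) * f' (fst q)\<bar> \<le> \<eta> * \<bar>hi q - fst q\<bar>"
          using D(2)[of "fst q" "lo q"] D(2)[of "fst q" "hi q"] Pq q by (auto simp: dist_real_def)
        \<comment> \<open>The values at the tag cancel, which leaves the difference of the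
          linearization errors at the two end points.\<close>
        moreover have "F q = (f (lo q) - f (fst q) - (lo q - fst q) * f' (fst q))
            - (f (hi q) - f (fst q) - (hi q - fst q) * f' (fst q))"
          using Pq q by (simp add: F_def g_def algebra_simps)
        ultimately have "\<bar>F q\<bar> \<le> \<eta> * \<bar>lo q - fst q\<bar> + \<eta> * \<bar>hi q - fst q\<bar>" by linarith
        also have "\<dots> = \<eta> * (hi q - lo q)" using Pq by (simp add: algebra_simps)
        finally show "\<bar>F q\<bar> \<le> \<eta> * (hi q - lo q)" .
      qed
      also have "\<dots> \<le> (\<Sum>q\<in>p. \<eta> * (hi q - lo q))"
      proof (intro sum_mono2[OF fin])
        fix q assume "q \<in> p - pG"
        then have "0 \<le> hi q - lo q" using P[of q] by simp
        then show "0 \<le> \<eta> * (hi q - lo q)" using \<eta> by simp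
      qed (auto simp: pG_def)
      also have "\<dots> = \<eta> * (d - c)" by (simp add: dc sum_distrib_left)
      also have "\<dots> < e / 2" using cd e by (simp add: \<eta>_def field_simps)
      finally have G: "\<bar>sum F pG\<bar> < e / 2" .
      \<comment> \<open>Absolute continuity speaks of finite sequences of intervals, so the pieces
        tagged in \<open>N\<close> are numbered.\<close>
      obtain b where b: "bij_betw b {..<card pN} pN"
        using ex_bij_betw_nat_finite[OF finN] by (auto simp: atLeast0LessThan)
      have bp: "b i \<in> p" "fst (b i) \<in> N" if "i < card pN" for i
        using b that by (auto simp: bij_betw_def pN_def)
      have bords: "c \<le> lo (b i) \<and> lo (b i) \<le> hi (b i) \<and> hi (b i) \<le> d" if "i < card pN" for i
        using P[OF bp(1)[OF that]] by linarith
      have bdisj: "{lo (b i)<..<hi (b i)} \<inter> {lo (b j)<..<hi (b j)} = {}"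
        if "i < card pN" "j < card pN" "i \<noteq> j" for i j
        using that b bp by (intro disj) (auto simp: bij_betw_def inj_on_def)
      have sub: "{lo (b i)<..<hi (b i)} \<subseteq> U" if "i < card pN" for i
      proof -
        have "snd (b i) \<subseteq> U"
          using fineD[OF fine, of "fst (b i)" "snd (b i)"] bp[OF that] by (simp add: \<gamma>_def)
        then show ?thesis using P[OF bp(1)[OF that]] by auto
      qed
      have "ennreal (\<Sum>i<card pN. hi (b i) - lo (b i)) = (\<Sum>i<card pN. ennreal (hi (b i) - lo (b i)))"
        using bords by (subst sum_ennreal) auto
      also have "\<dots> = (\<Sum>i<card pN. emeasure lborel {lo (b i)<..<hi (b i)})"
        using bords by (intro sum.cong) auto
      also have "\<dots> = emeasure lborel (\<Union>i<card pN. {lo (b i)<..<hi (b i)})"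
        using bdisj by (intro sum_emeasure) (auto simp: disjoint_family_on_def)
      also have "\<dots> \<le> emeasure lborel U" using sub Us by (intro emeasure_mono) auto
      also have "\<dots> < ennreal \<delta>" by (rule Um)
      finally have len: "(\<Sum>i<card pN. hi (b i) - lo (b i)) < \<delta>" by (meson ennreal_leI not_less)
      have "(\<Sum>i<card pN. \<bar>f (hi (b i)) - f (lo (b i))\<bar>) < e / 2"
      proof (rule small[THEN spec, THEN spec, THEN spec, THEN mp, THEN mp, THEN mp])
        show "\<forall>i<card pN. c \<le> lo (b i) \<and> lo (b i) \<le> hi (b i) \<and> hi (b i) \<le> d"
          using bords by blast
        show "\<forall>i<card pN. \<forall>j<card pN. i \<noteq> j \<longrightarrow> {lo (b i)<..<hi (b i)} \<inter> {lo (b j)<..<hi (b j)} = {}"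
        proof (intro allI impI)
          fix i j assume "i < card pN" "j < card pN" "i \<noteq> j"
          then show "{lo (b i)<..<hi (b i)} \<inter> {lo (b j)<..<hi (b j)} = {}" by (rule bdisj)
        qed
        show "(\<Sum>i<card pN. hi (b i) - lo (b i)) < \<delta>" by (rule len)
      qed
      moreover have "(\<Sum>i<card pN. \<bar>f (hi (b i)) - f (lo (b i))\<bar>) = (\<Sum>q\<in>pN. \<bar>f (hi q) - f (lo q)\<bar>)"
        by (rule sum.reindex_bij_betw[OF b])
      moreover have "\<bar>sum F pN\<bar> \<le> (\<Sum>q\<in>pN. \<bar>f (hi q) - f (lo q)\<bar>)"
        by (rule order_trans[OF sum_abs], rule sum_mono) (auto simp: F_def g_def pN_def)
      ultimately have "\<bar>sum F pN\<bar> < e / 2" by simp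
      then show ?thesis using G unfolding eq by simp
    qed
    show "\<exists>\<gamma>. gauge \<gamma> \<and> (\<forall>p. p tagged_division_of {c..d} \<and> \<gamma> fine p \<longrightarrow>
        norm ((\<Sum>(x, K)\<in>p. measure lborel K *\<^sub>R g x) - (f d - f c)) < e)"
      by (intro exI[of _ \<gamma>] conjI gauge allI impI) (elim conjE, rule main)
  qed
  then show ?thesis
    by (rule has_integral_spike[OF N, rotated]) (simp add: g_def)
qed

subsection \<open>Contraction for averaged delayed feedback\<close>

text \<open>\<open>rise\<close> and \<open>fall\<close> are what the contraction argument keeps of
  the equation: slope bounds in the time scale \<open>A\<close>, free of derivatives. The constant
  \<open>c\<close> may have either sign; a negative one forces decrease. The bound
  \<open>11/8\<close> makes the contraction factor \<open>r - 3/8\<close> less than 1.\<close>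

locale delayed_average =
  fixes x A :: "real \<Rightarrow> real" and K :: "'k set" and h :: "'k \<Rightarrow> real \<Rightarrow> real" and p r :: real
  assumes p: "0 \<le> p"
    and x_cont: "continuous_on {p..} x"
    and A_cont: "continuous_on {p..} A"
    and A_mono: "\<lbrakk>0 \<le> s; s \<le> t\<rbrakk> \<Longrightarrow> A s \<le> A t"
    and A_unbounded: "filterlim A at_top at_top"
    and h_le: "\<lbrakk>k \<in> K; p \<le> t\<rbrakk> \<Longrightarrow> h k t \<le> t"
    and h_nonneg: "\<lbrakk>k \<in> K; p \<le> t\<rbrakk> \<Longrightarrow> 0 \<le> h k t"
    and window: "\<lbrakk>k \<in> K; p \<le> t\<rbrakk> \<Longrightarrow> A t - A (h k t) \<le> r"
    and r: "1 \<le> r" "r < 11/8"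
    and rise: "\<lbrakk>p \<le> s; s \<le> t; \<And>\<tau> k. \<lbrakk>k \<in> K; s \<le> \<tau>; \<tau> \<le> t\<rbrakk> \<Longrightarrow> - c \<le> x (h k \<tau>)\<rbrakk>
      \<Longrightarrow> x t - x s \<le> c * (A t - A s)"
    and fall: "\<lbrakk>p \<le> s; s \<le> t; \<And>\<tau> k. \<lbrakk>k \<in> K; s \<le> \<tau>; \<tau> \<le> t\<rbrakk> \<Longrightarrow> x (h k \<tau>) \<le> c\<rbrakk>
      \<Longrightarrow> x s - x t \<le> c * (A t - A s)"
begin

text \<open>A sign change swaps \<open>rise\<close> and \<open>fall\<close>, so it suffices to bound
  \<open>x\<close> from above.\<close>

lemma reflect: "delayed_average (\<lambda>t. - x t) A K h p r"
proof
  show "continuous_on {p..} (\<lambda>t. - x t)" by (intro continuous_intros x_cont)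
next
  fix s t c assume "p \<le> s" "s \<le> t" "\<And>\<tau> k. \<lbrakk>k \<in> K; s \<le> \<tau>; \<tau> \<le> t\<rbrakk> \<Longrightarrow> - c \<le> - x (h k \<tau>)"
  then show "- x t - - x s \<le> c * (A t - A s)" using fall[of s t c] by simp
next
  fix s t c assume "p \<le> s" "s \<le> t" "\<And>\<tau> k. \<lbrakk>k \<in> K; s \<le> \<tau>; \<tau> \<le> t\<rbrakk> \<Longrightarrow> - x (h k \<tau>) \<le> c"
  then show "- x s - - x t \<le> c * (A t - A s)" using rise[of s t c] by fastforce
qed (use p A_cont A_mono A_unbounded h_le h_nonneg window r in auto)

lemma A_level:
  assumes "p \<le> s" "s \<le> t" "A s \<le> y" "y \<le> A t"
  obtains q where "s \<le> q" "q \<le> t" "A q = y"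
  using IVT'[of A s y t] assms continuous_on_subset[OF A_cont, of "{s..t}"] by auto

lemma A_reach:
  assumes "p \<le> s" "A s \<le> y"
  obtains q where "s \<le> q" "A q = y"
proof -
  have "\<forall>\<^sub>F t in at_top. y \<le> A t" using A_unbounded by (simp add: filterlim_at_top)
  then obtain t where "s \<le> t" "y \<le> A t"
    by (metis eventually_at_top_linorder linorder_le_cases)
  then show thesis using A_level[of s t y] assms that by metis
qed

text \<open>\<open>A\<close> need not be strictly increasing, so the order of two times is read off
  from a gap in \<open>A\<close>; 3/2 is a convenient number above \<open>r\<close>.\<close>

lemma h_ge:
  assumes "p \<le> s" "k \<in> K" "s \<le> t" "A s + 3/2 \<le> A t"
  shows "s \<le> h k t"
proof (rule ccontr)
  assume "\<not> s \<le> h k t"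
  then have "A (h k t) \<le> A s" using A_mono h_nonneg[of k t] assms by simp
  then show False using window[of k t] assms r by simp
qed

text \<open>A delayed argument \<open>y\<close> after \<open>u\<close> meets a nonnegative value.
  For \<open>y\<close> before \<open>u\<close>, \<open>- x y\<close> is at most \<open>V\<close>,
  and also at most \<open>V\<close> times the \<open>A\<close>-distance from \<open>y\<close> to the
  zero \<open>u\<close>, which the delay bound limits to \<open>r - s\<close>. The disjunction on
  \<open>c\<close> says that \<open>c\<close> is at least the minimum of 1 and \<open>r - s\<close>.
  The gap 3 leaves room for two successive delays after \<open>w\<close>.\<close>

lemma delayed_value_ge:
  assumes w: "p \<le> w" and u: "w \<le> u" "A w + 3 \<le> A u" and zero: "x u = 0"
    and pos: "\<And>y. \<lbrakk>u \<le> y; y \<le> t\<rbrakk> \<Longrightarrow> 0 \<le> x y"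
    and bd: "\<And>y. \<lbrakk>w \<le> y; y \<le> u\<rbrakk> \<Longrightarrow> \<bar>x y\<bar> \<le> V"
    and \<tau>: "k \<in> K" "u \<le> \<tau>" "\<tau> \<le> t" and s: "A u + s \<le> A \<tau>"
    and c: "0 \<le> c" "1 \<le> c \<or> r - s \<le> c"
  shows "- (V * c) \<le> x (h k \<tau>)"
proof -
  define y where "y = h k \<tau>"
  have V: "0 \<le> V" using bd[of u] u by force
  have A\<tau>: "A u \<le> A \<tau>" using A_mono p w u \<tau> by simp
  have yw: "w \<le> y" unfolding y_def using h_ge[of w k \<tau>] w u \<tau> A\<tau> by simp
  have y\<tau>: "y \<le> \<tau>" unfolding y_def using h_le w u \<tau> by simp
  have "- (V * c) \<le> x y"
  proof (cases "u \<le> y")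
    case True
    then show ?thesis using pos[of y] y\<tau> \<tau> V c(1) by (meson mult_nonneg_nonneg neg_le_0_iff_le order_trans)
  next
    case False
    then have yu: "y \<le> u" by simp
    have 1: "- x y \<le> V" using bd[OF yw yu] by simp
    have Ay: "A \<tau> - r \<le> A y" unfolding y_def using window[of k \<tau>] w u \<tau> by simp
    have "x u - x y \<le> V * (A u - A y)"
    proof (rule rise)
      fix \<tau>' k' assume *: "k' \<in> K" "y \<le> \<tau>'" "\<tau>' \<le> u"
      have "A y \<le> A \<tau>'" using A_mono p w yw * by simp
      then have "w \<le> h k' \<tau>'" using h_ge[of w k' \<tau>'] w yw * Ay A\<tau> u r by simp
      moreover have "h k' \<tau>' \<le> u" using h_le[of k' \<tau>'] w yw * by simp
      ultimately show "- V \<le> x (h k' \<tau>')" using bd[of "h k' \<tau>'"] by simp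
    qed (use w yw yu in auto)
    also have "\<dots> \<le> V * (r - s)" using Ay s V by (intro mult_left_mono) auto
    finally have 2: "- x y \<le> V * (r - s)" using zero by simp
    have "- x y \<le> V * c"
      using c(2)
    proof
      assume "1 \<le> c"
      then show ?thesis using 1 mult_left_mono[of 1 c V] V by simp
    next
      assume "r - s \<le> c"
      then show ?thesis using 2 mult_left_mono[of "r - s" c V] V by simp
    qed
    then show ?thesis by simp
  qed
  then show ?thesis by (simp add: y_def)
qed

text \<open>
  In the time scale \<open>\<sigma> = A t - A u\<close> the slope of \<open>x\<close> is at most \<open>V * min 1 (r - \<sigma>)\<close>. The bound is
  the upper Riemann sum of this function with step 1/4, which is still below \<open>V\<close> for \<open>r < 11/8\<close>
  (and \<open>1 + 1/e < 11/8\<close>).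
\<close>

lemma bound_after_zero:
  assumes w: "p \<le> w" and u: "w \<le> u" "A w + 3 \<le> A u" "u \<le> t" and zero: "x u = 0"
    and pos: "\<And>y. \<lbrakk>u \<le> y; y \<le> t\<rbrakk> \<Longrightarrow> 0 \<le> x y"
    and bd: "\<And>y. \<lbrakk>w \<le> y; y \<le> u\<rbrakk> \<Longrightarrow> \<bar>x y\<bar> \<le> V"
  shows "x t \<le> V * (r - 3/8)"
proof -
  have V: "0 \<le> V" using bd[of u] u by force
  \<comment> \<open>\<open>s\<close> is the \<open>A\<close>-time elapsed since \<open>u\<close>,
    and \<open>b\<close> is a bound on \<open>x\<close> in units of \<open>V\<close>.\<close>
  define P where "P s b \<longleftrightarrow> (\<forall>y. u \<le> y \<longrightarrow> y \<le> t \<longrightarrow> A y \<le> A u + s \<longrightarrow> x y \<le> V * b)" for s b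
  have step: "P s' (b + c * (s' - s))"
    if Ps: "P s b" "0 \<le> s" "s \<le> s'" "0 \<le> c" "1 \<le> c \<or> r - s \<le> c" for s s' b c
    unfolding P_def
  proof (intro allI impI)
    fix y assume y: "u \<le> y" "y \<le> t" "A y \<le> A u + s'"
    show "x y \<le> V * (b + c * (s' - s))"
    proof (cases "A y \<le> A u + s")
      case True
      then have "x y \<le> V * b" using Ps y by (simp add: P_def)
      also have "\<dots> \<le> V * (b + c * (s' - s))" using Ps V by (intro mult_left_mono) auto
      finally show ?thesis .
    next
      case False
      then obtain q where q: "u \<le> q" "q \<le> y" "A q = A u + s"
        using A_level[of u y "A u + s"] y Ps w u by auto
      have "x q \<le> V * b" using Ps q y by (simp add: P_def)
      moreover have "x y - x q \<le> V * c * (A y - A q)"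
      proof (rule rise)
        fix \<tau> k assume *: "k \<in> K" "q \<le> \<tau>" "\<tau> \<le> y"
        have "A u + s \<le> A \<tau>" using A_mono[of q \<tau>] p w u q * by simp
        then show "- (V * c) \<le> x (h k \<tau>)"
          using * q y u Ps
          by (intro delayed_value_ge[where w = w and u = u and t = t and s = s]) (auto intro: w zero pos bd)
      qed (use w u q in auto)
      moreover have "V * c * (A y - A q) \<le> V * c * (s' - s)"
        using y q V Ps by (intro mult_left_mono) auto
      ultimately show ?thesis by (simp add: algebra_simps)
    qed
  qed
  \<comment> \<open>\<open>A\<close> may stay constant for a while after \<open>u\<close>, so this
    concerns more than the point \<open>u\<close>; on such a stretch \<open>x\<close> cannot
    rise.\<close>
  have "P 0 0"
    unfolding P_def
  proof (intro allI impI)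
    fix y assume y: "u \<le> y" "y \<le> t" "A y \<le> A u + 0"
    have "x y - x u \<le> V * 1 * (A y - A u)"
      using y u w A_mono[of u] p
      by (intro rise delayed_value_ge[where w = w and u = u and t = t and s = 0])
         (auto intro: zero pos bd)
    also have "A y - A u = 0" using y A_mono[of u y] p w u by simp
    finally show "x y \<le> V * 0" using zero by simp
  qed
  \<comment> \<open>Cells of the Riemann sum start at 0, \<open>r - 3/4\<close>,
    \<open>r - 1/2\<close> and \<open>r - 1/4\<close>, with slope bounds 1, 3/4, 1/2 and 1/4. Their
    contributions \<open>r - 3/4\<close>, 3/16, 1/8 and 1/16 add up to
    \<open>r - 3/8\<close>.\<close>
  from step[OF this, of "r - 3/4" 1] have "P (r - 3/4) (r - 3/4)" using r by simp
  from step[OF this, of "r - 1/2" "3/4"] have "P (r - 1/2) (r - 9/16)" using r by (simp add: algebra_simps)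
  from step[OF this, of "r - 1/4" "1/2"] have "P (r - 1/4) (r - 7/16)" using r by (simp add: algebra_simps)
  from step[OF this, of r "1/4"] have "P r (r - 3/8)" using r by (simp add: algebra_simps)
  \<comment> \<open>After \<open>A\<close>-time \<open>r\<close> all delayed values are nonnegative
    and \<open>x\<close> no longer rises; the maximum also covers a \<open>t\<close> that comes
    earlier.\<close>
  from step[OF this, of "max r (A t - A u)" 0] have "P (max r (A t - A u)) (r - 3/8)" using r by simp
  then show ?thesis using u unfolding P_def by auto
qed

text \<open>\<open>u\<close> is the supremum of the closed set of points in \<open>{z..t}\<close>
  with \<open>x\<close> at most 0; a negative value there would force a still later zero.\<close>

lemma last_zero:
  assumes "p \<le> s" "s \<le> z" "z \<le> t" "x z \<le> 0" "0 < x t"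
  obtains u where "z \<le> u" "u \<le> t" "x u = 0" "\<And>y. \<lbrakk>u \<le> y; y \<le> t\<rbrakk> \<Longrightarrow> 0 \<le> x y"
proof -
  define S where "S = {z..t} \<inter> x -` {..0}"
  have cont: "continuous_on {z..t} x" by (rule continuous_on_subset[OF x_cont]) (use assms in auto)
  have "closed S" unfolding S_def
    by (rule continuous_closed_preimage[OF cont]) auto
  moreover have "S \<noteq> {}" "bdd_above S" using assms by (auto simp: S_def bdd_above_def)
  ultimately have "Sup S \<in> S" by (rule closed_contains_Sup[rotated 2])
  then have u: "z \<le> Sup S" "Sup S \<le> t" "x (Sup S) \<le> 0" by (auto simp: S_def)
  have pos: "0 < x y" if "Sup S < y" "y \<le> t" for y
  proof (rule ccontr)
    assume "\<not> 0 < x y"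
    then have "y \<in> S" using that u by (auto simp: S_def)
    then show False using cSup_upper[OF _ \<open>bdd_above S\<close>] that by force
  qed
  have "x (Sup S) = 0"
  proof (rule ccontr)
    assume "x (Sup S) \<noteq> 0"
    then have "x (Sup S) < 0" using u by simp
    moreover obtain v where "Sup S \<le> v" "v \<le> t" "x v = 0"
      using IVT'[of x "Sup S" 0 t] u assms continuous_on_subset[OF cont, of "{Sup S..t}"] by auto
    ultimately show False using pos[of v] by (metis less_irrefl order_le_less)
  qed
  then show thesis using that[of "Sup S"] u pos by (metis less_imp_le order_le_less)
qed

text \<open>The length 7 splits as 3 + 3/2 + 3/2 + 1. The first 3 units serve
  \<open>bound_after_zero\<close>. If \<open>x\<close> stays positive afterwards, one delay later it
  is nonincreasing, after a second delay all delayed values are at least \<open>x t\<close>, and in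
  the last unit \<open>x\<close> drops by at least \<open>x t\<close>.\<close>

lemma contract_upper:
  assumes w: "p \<le> w" "w \<le> t" "A w + 7 \<le> A t"
    and bd: "\<And>y. \<lbrakk>w \<le> y; y \<le> t\<rbrakk> \<Longrightarrow> \<bar>x y\<bar> \<le> V"
  shows "x t \<le> V * (r - 3/8)"
proof (cases "x t \<le> 0")
  case True
  moreover have "0 \<le> V" using bd[of t] w by force
  then have "0 \<le> V * (r - 3/8)" using r by simp
  ultimately show ?thesis by simp
next
  case False
  then have xt: "0 < x t" by simp
  have V: "0 \<le> V" using bd[of t] w by force
  obtain w2 where w2: "w \<le> w2" "w2 \<le> t" "A w2 = A w + 3" using A_level[of w t "A w + 3"] w by auto
  obtain w3 where w3: "w2 \<le> w3" "w3 \<le> t" "A w3 = A w2 + 3/2" using A_level[of w2 t "A w2 + 3/2"] w w2 by auto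
  obtain w4 where w4: "w3 \<le> w4" "w4 \<le> t" "A w4 = A w3 + 3/2" using A_level[of w3 t "A w3 + 3/2"] w w2 w3 by auto
  show ?thesis
  proof (cases "\<exists>z\<in>{w2..t}. x z \<le> 0")
    case True
    then obtain z where z: "w2 \<le> z" "z \<le> t" "x z \<le> 0" by auto
    obtain u where u: "z \<le> u" "u \<le> t" "x u = 0" "\<And>y. \<lbrakk>u \<le> y; y \<le> t\<rbrakk> \<Longrightarrow> 0 \<le> x y"
      using last_zero[of z z t] z w w2 xt by auto
    have "A w2 \<le> A u" using A_mono[of w2 u] p w w2 z u by simp
    then show ?thesis
      using w w2 z u bd by (intro bound_after_zero[of w u t V]) auto
  next
    case False
    then have pos: "0 < x y" if "w2 \<le> y" "y \<le> t" for y using that by force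
    have late: "w2 \<le> h k \<tau> \<and> h k \<tau> \<le> \<tau>" if "k \<in> K" "w3 \<le> \<tau>" "\<tau> \<le> t" for k \<tau>
      using h_ge[of w2 k \<tau>] h_le[of k \<tau>] A_mono[of w3 \<tau>] that w w2 w3 p by auto
    have dec: "x t \<le> x y" if "w3 \<le> y" "y \<le> t" for y
    proof -
      have "x t - x y \<le> 0 * (A t - A y)"
      proof (rule rise)
        fix \<tau> k assume "k \<in> K" "y \<le> \<tau>" "\<tau> \<le> t"
        then show "- 0 \<le> x (h k \<tau>)" using pos[of "h k \<tau>"] late[of k \<tau>] that by simp
      qed (use that w w2 w3 in auto)
      then show ?thesis by simp
    qed
    \<comment> \<open>\<open>rise\<close> is applied with the negative constant
      \<open>- x t\<close>.\<close>
    have "x t - x w4 \<le> - x t * (A t - A w4)"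
    proof (rule rise)
      fix \<tau> k assume *: "k \<in> K" "w4 \<le> \<tau>" "\<tau> \<le> t"
      then have "w3 \<le> h k \<tau>"
        using h_ge[of w3 k \<tau>] A_mono[of w4 \<tau>] w w2 w3 w4 p by auto
      moreover have "h k \<tau> \<le> t" using * late[of k \<tau>] w4 by simp
      ultimately show "- (- x t) \<le> x (h k \<tau>)" using dec by simp
    qed (use w w2 w3 w4 in auto)
    moreover have "x t * 1 \<le> x t * (A t - A w4)"
      using xt w w2 w3 w4 by (intro mult_left_mono) auto
    moreover have "x w4 \<le> V" using bd[of w4] w w2 w3 w4 by simp
    ultimately have "x t \<le> V * (1/2)" by simp
    also have "\<dots> \<le> V * (r - 3/8)" using V r by (intro mult_left_mono) auto
    finally show ?thesis .
  qed
qed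

lemma contract:
  assumes "p \<le> w" "w \<le> t" "A w + 7 \<le> A t"
    and "\<And>y. \<lbrakk>w \<le> y; y \<le> t\<rbrakk> \<Longrightarrow> \<bar>x y\<bar> \<le> V"
  shows "\<bar>x t\<bar> \<le> V * (r - 3/8)"
  using contract_upper[of w t V] delayed_average.contract_upper[OF reflect, of w t V] assms
  by (simp add: abs_le_iff)

text \<open>At the first point from \<open>w'\<close> on where |x| reaches \<open>V\<close>, the
  bound holds on the whole window behind it, so \<open>contract\<close> puts the value there
  strictly below \<open>V\<close>.\<close>

lemma bound_persists:
  assumes w: "p \<le> w" "w \<le> w'" "A w' = A w + 7" and V: "0 < V"
    and bd: "\<And>y. \<lbrakk>w \<le> y; y \<le> w'\<rbrakk> \<Longrightarrow> \<bar>x y\<bar> \<le> V"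
    and t: "w \<le> t"
  shows "\<bar>x t\<bar> \<le> V"
proof (rule ccontr)
  assume viol: "\<not> \<bar>x t\<bar> \<le> V"
  then have wt: "w' \<le> t" using bd t by force
  have cont: "continuous_on {w..t} (\<lambda>y. \<bar>x y\<bar>)"
    by (intro continuous_intros continuous_on_subset[OF x_cont]) (use w in auto)
  define S where "S = {w'..t} \<inter> (\<lambda>y. \<bar>x y\<bar>) -` {V..}"
  have "closed S" unfolding S_def
    by (rule continuous_closed_preimage[OF continuous_on_subset[OF cont]]) (use w in auto)
  moreover have "S \<noteq> {}" "bdd_below S" using viol wt by (auto simp: S_def bdd_below_def)
  ultimately have "Inf S \<in> S" by (rule closed_contains_Inf[rotated 2])
  then have I: "w' \<le> Inf S" "Inf S \<le> t" "V \<le> \<bar>x (Inf S)\<bar>" by (auto simp: S_def)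
  have below: "\<bar>x y\<bar> \<le> V" if "w \<le> y" "y < Inf S" for y
  proof (cases "y \<le> w'")
    case False
    then have "y \<notin> S" using cInf_lower[OF _ \<open>bdd_below S\<close>, of y] that by auto
    then show ?thesis using False that I by (auto simp: S_def)
  qed (use bd that in simp)
  \<comment> \<open>The end point gets the bound from the left limit, or from the hypothesis if it
    is \<open>w'\<close>.\<close>
  have at: "\<bar>x (Inf S)\<bar> \<le> V"
  proof (cases "Inf S = w'")
    case False
    have "continuous_on {w..Inf S} (\<lambda>y. \<bar>x y\<bar>)" using cont by (rule continuous_on_subset) (use I in auto)
    then have "((\<lambda>y. \<bar>x y\<bar>) \<longlongrightarrow> \<bar>x (Inf S)\<bar>) (at_left (Inf S))"
      using continuous_on_Icc_at_leftD[of w "Inf S" "\<lambda>y. \<bar>x y\<bar>"] I w False by simp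
    moreover have "\<forall>\<^sub>F y in at_left (Inf S). \<bar>x y\<bar> \<le> V"
      using eventually_at_left_real[of w "Inf S"] False I w by (auto elim!: eventually_mono intro: below)
    ultimately show ?thesis by (rule tendsto_upperbound) simp
  qed (use bd w in simp)
  have "A w' \<le> A (Inf S)" using A_mono[of w' "Inf S"] p w I by simp
  then have "\<bar>x (Inf S)\<bar> \<le> V * (r - 3/8)"
    using w I below at by (intro contract[of w]) (auto simp: order_le_less)
  also have "\<dots> < V * 1" using V r by (intro mult_strict_left_mono) auto
  finally show False using I by simp
qed

text \<open>Induction over windows: stage \<open>n\<close> bounds |x| on all of
  \<open>{v..t}\<close>, where \<open>v\<close> lies \<open>7 * n\<close> units after
  \<open>w\<close>, and \<open>contract\<close> gains one more factor. Stage 0 is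
  \<open>bound_persists\<close>.\<close>

lemma geometric_decay:
  assumes w: "p \<le> w" "w \<le> w'" "A w' = A w + 7" and V: "0 < V"
    and bd: "\<And>y. \<lbrakk>w \<le> y; y \<le> w'\<rbrakk> \<Longrightarrow> \<bar>x y\<bar> \<le> V"
  shows "\<lbrakk>w \<le> t; A w + 7 * real n \<le> A t\<rbrakk> \<Longrightarrow> \<bar>x t\<bar> \<le> V * (r - 3/8) ^ n"
proof (induction n arbitrary: t)
  case 0
  then show ?case using bound_persists[OF w V bd] by simp
next
  case (Suc n)
  obtain v where v: "w \<le> v" "v \<le> t" "A v = A w + 7 * real n"
    using A_level[of w t "A w + 7 * real n"] Suc.prems w by auto
  have "\<bar>x t\<bar> \<le> (V * (r - 3/8) ^ n) * (r - 3/8)"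
  proof (rule contract)
    fix y assume y: "v \<le> y" "y \<le> t"
    show "\<bar>x y\<bar> \<le> V * (r - 3/8) ^ n" using Suc.IH[of y] A_mono[of v y] p w v y by simp
  qed (use v w Suc.prems in auto)
  then show ?case by (simp add: mult_ac)
qed

end

subsection \<open>Solutions of the delay equation\<close>

lemma continuous_on_atLeast_if_has_integral:
  fixes F g :: "real \<Rightarrow> real"
  assumes "\<And>t. c \<le> t \<Longrightarrow> (g has_integral (F t - F c)) {c..t}"
  shows "continuous_on {c..} F"
  unfolding continuous_on_eq_continuous_within
proof
  fix t assume t: "t \<in> {c..}"
  have "continuous_on {c..t + 1} (\<lambda>s. F c + integral {c..s} g)"
    using assms[of "t + 1"] t
    by (intro continuous_intros indefinite_integral_continuous_1) (auto simp: integrable_on_def)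
  then have "continuous_on {c..t + 1} F"
    by (rule continuous_on_eq) (simp add: integral_unique[OF assms])
  then have "continuous (at t within {c..t + 1}) F"
    using t by (simp add: continuous_on_eq_continuous_within)
  moreover have "at t within {c..t + 1} = at t within {c..}"
    by (rule at_within_nhd[of t "{..<t + 1}"]) auto
  ultimately show "continuous (at t within {c..}) F" by simp
qed

text \<open>Absolute continuity allows the almost everywhere equation to be integrated; the later
  estimates of solutions rest on this identity.\<close>

lemma dde_solution_has_integral:
  assumes sol: "dde_solution m a h t0 \<phi> x0 x" and st: "t0 \<le> s" "s \<le> t"
  shows "((\<lambda>\<tau>. - (\<Sum>k=1..m. a k \<tau> * x (h k \<tau>))) has_integral (x t - x s)) {s..t}"
proof -
  have "AE \<tau> in lebesgue_on {t0..}. (x has_real_derivative - (\<Sum>k=1..m. a k \<tau> * x (h k \<tau>))) (at \<tau>)"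
  proof -
    have "AE \<tau> in lebesgue_on {t0..}. \<exists>x'. (x has_real_derivative x') (at \<tau>)
        \<and> x' + (\<Sum>k=1..m. a k \<tau> * x (h k \<tau>)) = 0"
      using sol unfolding dde_solution_def by blast
    then show ?thesis
      by (rule eventually_mono) (auto simp: eq_neg_iff_add_eq_0[symmetric])
  qed
  then obtain N where N: "N \<in> null_sets (lebesgue_on {t0..})"
    and der: "\<And>\<tau>. \<lbrakk>t0 \<le> \<tau>; \<tau> \<notin> N\<rbrakk> \<Longrightarrow> (x has_real_derivative - (\<Sum>k=1..m. a k \<tau> * x (h k \<tau>))) (at \<tau>)"
    by (elim AE_E3) auto
  have neg: "negligible N"
    using N by (simp add: null_sets_restrict_space negligible_iff_null_sets)
  have ac: "abs_continuous_on_interval x s t"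
    using sol st by (simp add: dde_solution_def locally_abs_continuous_from_def)
  show ?thesis
  proof (rule abs_continuous_has_integral[OF ac st(2) neg])
    fix \<tau> assume "\<tau> \<in> {s..t} - N"
    then have "t0 \<le> \<tau>" "\<tau> \<notin> N" using st by auto
    then show "(x has_real_derivative - (\<Sum>k=1..m. a k \<tau> * x (h k \<tau>))) (at \<tau> within {s..t})"
      by (rule has_field_derivative_at_within[OF der])
  qed
qed

section \<open>The time scale \<open>A\<close> and the growth of solutions measured in it\<close>

locale dde =
  fixes m :: nat and a h :: "nat \<Rightarrow> real \<Rightarrow> real"
  assumes h_le: "\<lbrakk>k \<in> {1..m}; 0 \<le> t\<rbrakk> \<Longrightarrow> h k t \<le> t"
    and a_nonneg: "\<lbrakk>k \<in> {1..m}; 0 \<le> t\<rbrakk> \<Longrightarrow> 0 \<le> a k t"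
    and a_integrable: "0 \<le> t \<Longrightarrow> (\<lambda>s. \<Sum>k=1..m. a k s) integrable_on {0..t}"
begin

text \<open>A gauge integral, so that the \<open>has_integral\<close> calculus applies;
  \<open>A_nn_integral\<close> and \<open>A_set_lebesgue_integral\<close> link it to Lebesgue
  integrals.\<close>

definition A :: "real \<Rightarrow> real" where
  "A t = integral {0..t} (\<lambda>s. \<Sum>k=1..m. a k s)"

lemma A_has_integral:
  assumes "0 \<le> s" "s \<le> t"
  shows "((\<lambda>\<tau>. \<Sum>k=1..m. a k \<tau>) has_integral (A t - A s)) {s..t}"
proof -
  have "integral {0..s} (\<lambda>\<tau>. \<Sum>k=1..m. a k \<tau>) + integral {s..t} (\<lambda>\<tau>. \<Sum>k=1..m. a k \<tau>) = A t"
    unfolding A_def using assms a_integrable[of t] by (intro Henstock_Kurzweil_Integration.integral_combine) auto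
  moreover have "(\<lambda>\<tau>. \<Sum>k=1..m. a k \<tau>) integrable_on {s..t}"
    using a_integrable[of t] assms by (auto intro: integrable_on_subinterval)
  ultimately show ?thesis by (simp add: A_def has_integral_iff algebra_simps)
qed

lemma A_0: "A 0 = 0"
  by (simp add: A_def)

lemma A_mono: "\<lbrakk>0 \<le> s; s \<le> t\<rbrakk> \<Longrightarrow> A s \<le> A t"
  using has_integral_nonneg[OF A_has_integral, of s t] a_nonneg by (force intro: sum_nonneg)

lemma A_continuous: "0 \<le> s \<Longrightarrow> continuous_on {s..} A"
  by (rule continuous_on_atLeast_if_has_integral[OF A_has_integral])

context
  fixes t0 x0 :: real and \<phi> x :: "real \<Rightarrow> real"
  assumes sol: "dde_solution m a h t0 \<phi> x0 x" and t0: "0 \<le> t0"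
begin

lemma solution_continuous: "t0 \<le> s \<Longrightarrow> continuous_on {s..} x"
  by (rule continuous_on_atLeast_if_has_integral[OF dde_solution_has_integral[OF sol]])

text \<open>Nonnegative coefficients turn a lower bound on the delayed values into a pointwise bound
  of the integrand by \<open>c\<close> times the density of \<open>A\<close>. Together with
  \<open>solution_fall\<close> this feeds \<open>delayed_average\<close>.\<close>

lemma solution_rise:
  assumes "t0 \<le> s" "s \<le> t" and "\<And>\<tau> k. \<lbrakk>k \<in> {1..m}; s \<le> \<tau>; \<tau> \<le> t\<rbrakk> \<Longrightarrow> - c \<le> x (h k \<tau>)"
  shows "x t - x s \<le> c * (A t - A s)"
proof (rule has_integral_le[OF dde_solution_has_integral[OF sol]])
  show "((\<lambda>\<tau>. c * (\<Sum>k=1..m. a k \<tau>)) has_integral c * (A t - A s)) {s..t}"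
    using A_has_integral[of s t] assms t0 by (intro has_integral_mult_right) auto
  fix \<tau> assume \<tau>: "\<tau> \<in> {s..t}"
  have "(\<Sum>k=1..m. a k \<tau> * - c) \<le> (\<Sum>k=1..m. a k \<tau> * x (h k \<tau>))"
    using assms \<tau> t0 by (intro sum_mono mult_left_mono a_nonneg) auto
  moreover have "(\<Sum>k=1..m. a k \<tau> * - c) = - (c * (\<Sum>k=1..m. a k \<tau>))"
    by (simp add: sum_negf sum_distrib_left mult.commute)
  ultimately show "- (\<Sum>k=1..m. a k \<tau> * x (h k \<tau>)) \<le> c * (\<Sum>k=1..m. a k \<tau>)" by linarith
qed (use assms in auto)

lemma solution_fall:
  assumes "t0 \<le> s" "s \<le> t" and "\<And>\<tau> k. \<lbrakk>k \<in> {1..m}; s \<le> \<tau>; \<tau> \<le> t\<rbrakk> \<Longrightarrow> x (h k \<tau>) \<le> c"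
  shows "x s - x t \<le> c * (A t - A s)"
proof -
  have "- c * (A t - A s) \<le> x t - x s"
  proof (rule has_integral_le[OF _ dde_solution_has_integral[OF sol]])
    show "((\<lambda>\<tau>. - c * (\<Sum>k=1..m. a k \<tau>)) has_integral - c * (A t - A s)) {s..t}"
      using A_has_integral[of s t] assms t0 by (intro has_integral_mult_right) auto
    fix \<tau> assume \<tau>: "\<tau> \<in> {s..t}"
    have "(\<Sum>k=1..m. a k \<tau> * x (h k \<tau>)) \<le> (\<Sum>k=1..m. a k \<tau> * c)"
      using assms \<tau> t0 by (intro sum_mono mult_left_mono a_nonneg) auto
    moreover have "(\<Sum>k=1..m. a k \<tau> * c) = c * (\<Sum>k=1..m. a k \<tau>)"
      by (simp add: sum_distrib_left mult.commute)
    ultimately show "- c * (\<Sum>k=1..m. a k \<tau>) \<le> - (\<Sum>k=1..m. a k \<tau> * x (h k \<tau>))" by simp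
  qed (use assms in auto)
  then show ?thesis by simp
qed

text \<open>Over \<open>A\<close>-length 1/2 the solution moves by at most half of its largest
  absolute value, so a maximum exceeding \<open>C\<close> is at most \<open>C\<close> plus half of
  itself. Delays of any length are allowed, since \<open>C\<close> bounds the entire history up to
  \<open>q\<close>.\<close>

lemma solution_doubling:
  assumes q: "t0 \<le> q" "q \<le> t" "A t \<le> A q + 1/2" and bd: "\<And>y. y \<le> q \<Longrightarrow> \<bar>x y\<bar> \<le> C"
  shows "\<bar>x t\<bar> \<le> 2 * C"
proof -
  have "continuous_on {q..t} (\<lambda>y. \<bar>x y\<bar>)"
    by (intro continuous_intros continuous_on_subset[OF solution_continuous[of q]]) (use q in auto)
  then obtain z where z: "q \<le> z" "z \<le> t" "\<And>y. \<lbrakk>q \<le> y; y \<le> t\<rbrakk> \<Longrightarrow> \<bar>x y\<bar> \<le> \<bar>x z\<bar>"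
    using continuous_attains_sup[of "{q..t}" "\<lambda>y. \<bar>x y\<bar>"] q by auto
  define M where "M = max C \<bar>x z\<bar>"
  have "\<bar>x (h k \<tau>)\<bar> \<le> M" if "k \<in> {1..m}" "q \<le> \<tau>" "\<tau> \<le> z" for k \<tau>
  proof -
    have "h k \<tau> \<le> t" using h_le[of k \<tau>] that q z t0 by simp
    then show ?thesis using bd[of "h k \<tau>"] z(3)[of "h k \<tau>"] unfolding M_def by linarith
  qed
  then have "- M \<le> x (h k \<tau>)" "x (h k \<tau>) \<le> M" if "k \<in> {1..m}" "q \<le> \<tau>" "\<tau> \<le> z" for k \<tau>
    using that by (auto simp: abs_le_iff minus_le_iff)
  then have "\<bar>x z - x q\<bar> \<le> M * (A z - A q)"
    using solution_rise[of q z M] solution_fall[of q z M] q z by (simp add: abs_le_iff)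
  also have "\<dots> \<le> M * (1/2)"
    using A_mono[of z t] q z t0 by (intro mult_left_mono) (auto simp: M_def)
  finally have "\<bar>x z\<bar> \<le> C + M / 2" using bd[of q, OF order_refl] by linarith
  moreover have "0 \<le> C" using bd[of q] by force
  ultimately have "\<bar>x z\<bar> \<le> 2 * C" by (auto simp: M_def max_def split: if_splits)
  then show ?thesis using z(3)[of t] q by simp
qed

text \<open>Controls the initial phase, where delays may still be long, at the cost of a factor 2
  per half unit of \<open>A\<close>-time. The case \<open>t \<le> t0\<close> carries the initial
  history through the induction.\<close>

lemma solution_growth:
  assumes "\<And>y. y \<le> t0 \<Longrightarrow> \<bar>x y\<bar> \<le> B"
  shows "t \<le> t0 \<or> A t \<le> A t0 + real n / 2 \<Longrightarrow> \<bar>x t\<bar> \<le> 2 ^ Suc n * B"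
proof (induction n arbitrary: t)
  case 0
  have "0 \<le> B" using assms[of t0] by force
  then show ?case using 0 solution_doubling[of t0 t B] assms by (cases "t \<le> t0") (force intro: order_trans)+
next
  case (Suc n)
  have B: "0 \<le> B" using assms[of t0] by force
  show ?case
  proof (cases "t \<le> t0 \<or> A t \<le> A t0 + real n / 2")
    case True
    then have "\<bar>x t\<bar> \<le> 2 ^ Suc n * B" by (rule Suc.IH)
    then show ?thesis using B by simp
  next
    case False
    then obtain q where q: "t0 \<le> q" "q \<le> t" "A q = A t0 + real n / 2"
      using IVT'[of A t0 "A t0 + real n / 2" t] continuous_on_subset[OF A_continuous[OF t0], of "{t0..t}"]
      by auto
    have "\<bar>x t\<bar> \<le> 2 * (2 ^ Suc n * B)"
    proof (rule solution_doubling)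
      fix y assume "y \<le> q"
      then show "\<bar>x y\<bar> \<le> 2 ^ Suc n * B"
        using A_mono[of y q] q t0 by (intro Suc.IH) linarith
    qed (use q Suc.prems False in \<open>auto simp: field_simps\<close>)
    then show ?thesis by simp
  qed
qed

end

text \<open>The delay bounds hold from \<open>max T t0\<close> on, and the \<open>A\<close>-time
  from \<open>t0\<close> to that point is at most \<open>A T\<close> whatever \<open>t0\<close> is.
  So the initial phase costs a fixed factor, and the constants can be chosen before the
  solution.\<close>

lemma uniform_decay:
  assumes unb: "filterlim A at_top at_top" and T: "0 \<le> T" and r: "1 \<le> r" "r < 11/8"
    and h_nonneg: "\<And>k t. \<lbrakk>k \<in> {1..m}; T \<le> t\<rbrakk> \<Longrightarrow> 0 \<le> h k t"
    and window: "\<And>k t. \<lbrakk>k \<in> {1..m}; T \<le> t\<rbrakk> \<Longrightarrow> A t - A (h k t) \<le> r"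
  obtains C \<kappa> where "0 < C" "0 < \<kappa>"
    "\<And>t0 \<phi> x0 x B t. \<lbrakk>dde_solution m a h t0 \<phi> x0 x; 0 \<le> t0; 0 < B; \<And>y. y \<le> t0 \<Longrightarrow> \<bar>x y\<bar> \<le> B; t0 \<le> t\<rbrakk>
      \<Longrightarrow> \<bar>x t\<bar> \<le> C * B * exp (- \<kappa> * (A t - A t0))"
proof -
  define \<theta> where "\<theta> = r - 3/8"
  have \<theta>: "0 < \<theta>" "\<theta> < 1" using r by (auto simp: \<theta>_def)
  \<comment> \<open>Chosen so that one factor \<theta> per 7 units of \<open>A\<close>-time is decay
    at rate \<kappa>.\<close>
  define \<kappa> where "\<kappa> = - ln \<theta> / 7"
  have \<kappa>: "0 < \<kappa>" using \<theta> by (simp add: \<kappa>_def)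
  \<comment> \<open>\<open>N\<close> half units of \<open>A\<close>-time reach from
    \<open>t0\<close> to the end \<open>w\<close> of the first window, at most
    \<open>A T + 7\<close> units away.\<close>
  define N where "N = nat \<lceil>2 * (A T + 7)\<rceil>"
  define C where "C = 2 ^ Suc N * exp (\<kappa> * (A T + 7))"
  have "\<bar>x t\<bar> \<le> C * B * exp (- \<kappa> * (A t - A t0))"
    if sol: "dde_solution m a h t0 \<phi> x0 x" and t0: "0 \<le> t0" and B: "0 < B"
      and init: "\<And>y. y \<le> t0 \<Longrightarrow> \<bar>x y\<bar> \<le> B" and t: "t0 \<le> t" for t0 \<phi> x0 x B t
  proof -
    define p where "p = max T t0"
    have p: "0 \<le> p" "T \<le> p" "t0 \<le> p" using T by (auto simp: p_def)
    interpret delayed_average x A "{1..m}" h p r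
      by standard (use p solution_continuous[OF sol t0] A_continuous A_mono unb h_le h_nonneg window r
          solution_rise[OF sol t0] solution_fall[OF sol t0] in auto)
    have Ap: "A p - A t0 \<le> A T" using A_mono[of 0 t0] A_mono[of 0 T] A_0 t0 T by (auto simp: p_def max_def)
    obtain w where w: "p \<le> w" "A w = A p + 7" using A_reach[of p "A p + 7"] by auto
    define V where "V = 2 ^ Suc N * B"
    have V: "0 < V" using B by (simp add: V_def)
    have bd: "\<bar>x y\<bar> \<le> V" if "y \<le> w" for y
      unfolding V_def
    proof (rule solution_growth[OF sol t0 init])
      have "A y \<le> A t0 + real N / 2" if "t0 \<le> y"
      proof -
        have "A y \<le> A w" using A_mono[of y w] that t0 \<open>y \<le> w\<close> by simp
        moreover have "2 * (A T + 7) \<le> real N" unfolding N_def by linarith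
        ultimately show ?thesis using w Ap by simp
      qed
      then show "y \<le> t0 \<or> A y \<le> A t0 + real N / 2" by linarith
    qed
    \<comment> \<open>The shift by \<open>A T + 7\<close> makes the exponent nonnegative up to
      \<open>p\<close>; later it pays for the initial phase and the incomplete last window.\<close>
    have "\<bar>x t\<bar> \<le> V * exp (- \<kappa> * (A t - A t0 - A T - 7))"
    proof (cases "t \<le> p")
      case True
      then have "A t - A t0 - A T - 7 \<le> 0" using A_mono[of t p] Ap t t0 by simp
      then have "0 \<le> - \<kappa> * (A t - A t0 - A T - 7)" using \<kappa> by (simp add: mult_nonneg_nonpos)
      then have "V * 1 \<le> V * exp (- \<kappa> * (A t - A t0 - A T - 7))"
        using V by (intro mult_left_mono) auto
      then show ?thesis using bd[of t] True w by simp
    next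
      case False
      define n where "n = nat \<lfloor>(A t - A p) / 7\<rfloor>"
      have "A p \<le> A t" using A_mono[of p t] p False by simp
      then have "real n = real_of_int \<lfloor>(A t - A p) / 7\<rfloor>" by (simp add: n_def)
      then have n: "real n \<le> (A t - A p) / 7" "(A t - A p) / 7 \<le> real n + 1" by linarith+
      have "\<bar>x t\<bar> \<le> V * \<theta> ^ n"
        unfolding \<theta>_def by (rule geometric_decay[of p w]) (use w V bd False n in auto)
      also have "\<theta> ^ n = exp (- \<kappa> * (7 * real n))"
        using \<theta> by (simp add: \<kappa>_def exp_of_nat_mult mult.commute)
      also have "\<dots> \<le> exp (- \<kappa> * (A t - A t0 - A T - 7))"
        using n Ap \<kappa> by simp
      finally show ?thesis using V by simp
    qed
    also have "\<dots> = C * B * exp (- \<kappa> * (A t - A t0))"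
      by (simp add: C_def V_def algebra_simps flip: exp_add)
    finally show ?thesis .
  qed
  moreover have "0 < C" by (simp add: C_def)
  ultimately show thesis using that \<kappa> by blast
qed

end

section \<open>Initial data, the size of 1/e and integrability of the coefficients\<close>

lemma initial_bound:
  assumes "initial_function t0 \<phi>" "dde_solution m a h t0 \<phi> x0 x" "y \<le> t0"
  shows "\<bar>x y\<bar> \<le> \<bar>x t0\<bar> + initial_sup t0 \<phi>"
proof -
  obtain b where b: "\<And>t. t < t0 \<Longrightarrow> \<bar>\<phi> t\<bar> \<le> b"
    using assms(1) by (auto simp: initial_function_def bounded_iff)
  then have "bdd_above ((\<lambda>t. \<bar>\<phi> t\<bar>) ` {..<t0})" by (auto intro!: bdd_aboveI)
  then have sup: "\<bar>\<phi> t\<bar> \<le> initial_sup t0 \<phi>" if "t < t0" for t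
    unfolding initial_sup_def using that by (intro cSUP_upper) auto
  show ?thesis
  proof (cases "y < t0")
    case True
    then show ?thesis using assms(2) sup[of y] by (auto simp: dde_solution_def)
  next
    case False
    then have "y = t0" using assms(3) by simp
    \<comment> \<open>Any sample point before \<open>t0\<close> shows that the supremum is
      nonnegative.\<close>
    moreover have "0 \<le> initial_sup t0 \<phi>" using sup[of "t0 - 1"] by simp
    ultimately show ?thesis by simp
  qed
qed

text \<open>Puts \<open>1 + 1 / exp 1\<close> below \<open>11/8\<close>. The lower bound
  \<open>(1 + 1 / n) ^ n\<close> for \<open>exp 1\<close> already exceeds 8/3 at
  \<open>n = 30\<close>.\<close>

lemma inverse_exp_1_less: "1 / exp 1 < (3/8 :: real)"
proof -
  have "(1 + 1 / real 30) ^ 30 \<le> exp (1 :: real)"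
    by (rule exp_ge_one_plus_x_over_n_power_n) auto
  moreover have "(8/3 :: real) < (1 + 1 / real 30) ^ 30" by (simp add: power_divide)
  ultimately show ?thesis by (simp add: field_simps)
qed

lemma ess_bounded_integrable_on:
  fixes f :: "real \<Rightarrow> real"
  assumes meas: "f \<in> borel_measurable (lebesgue_on {0..})"
    and bound: "AE t in lebesgue_on {0..}. \<bar>f t\<bar> \<le> C"
    and nonneg: "\<And>t. 0 \<le> t \<Longrightarrow> 0 \<le> f t"
  shows "f integrable_on {0..T}"
proof -
  have "AE t in lebesgue. t \<in> {0..} \<longrightarrow> \<bar>f t\<bar> \<le> C"
    using bound by (simp add: AE_restrict_space_iff)
  then have "AE t in lebesgue_on {0..T}. \<bar>f t\<bar> \<le> C"
    by (auto simp: AE_restrict_space_iff elim!: eventually_mono)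
  moreover have "f \<in> borel_measurable (lebesgue_on {0..T})"
    using meas by (rule measurable_restrict_mono) auto
  ultimately have "integrable (lebesgue_on {0..T}) f"
    by (intro integrableI_bounded_set[where A = "{0..T}" and B = C])
       (auto simp: sets_restrict_space emeasure_restrict_space emeasure_lborel_Icc_eq)
  then show ?thesis by (rule integrable_on_lebesgue_on) auto
qed

section \<open>The integral conditions expressed through \<open>A\<close>\<close>

context dde
begin

lemma A_nn_integral:
  assumes "0 \<le> t"
  shows "(\<integral>\<^sup>+s\<in>{0..t}. ennreal (\<Sum>k=1..m. a k s) \<partial>lebesgue) = ennreal (A t)"
  unfolding nn_integral_completion
  using A_has_integral[of 0 t] assms a_nonneg A_0
  by (intro nn_integral_has_integral_lebesgue') (auto intro!: sum_nonneg)

lemma A_set_lebesgue_integral: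
  assumes "0 \<le> s" "s \<le> t"
  shows "(LINT \<tau>:{s..t}|lebesgue. (\<Sum>k=1..m. a k \<tau>)) = A t - A s"
proof -
  have "(\<lambda>\<tau>. \<Sum>k=1..m. a k \<tau>) absolutely_integrable_on {s..t}"
    using A_has_integral[OF assms] assms a_nonneg
    by (subst absolutely_integrable_on_iff_nonneg) (auto simp: integrable_on_def intro!: sum_nonneg)
  then show ?thesis
    using A_has_integral[OF assms] by (simp add: set_lebesgue_integral_eq_integral(2) integral_unique)
qed

text \<open>Monotone convergence for the truncations at integers \<open>n\<close>, whose integrals
  are \<open>A n\<close>, makes these values unbounded; monotonicity of \<open>A\<close> does the
  rest.\<close>

lemma A_at_top:
  assumes meas: "\<And>k. k \<in> {1..m} \<Longrightarrow> a k \<in> borel_measurable (lebesgue_on {0..})"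
    and inf: "(\<integral>\<^sup>+t\<in>{0..}. ennreal (\<Sum>k=1..m. a k t) \<partial>lebesgue) = \<infinity>"
  shows "filterlim A at_top at_top"
proof -
  define S where "S t = ennreal (\<Sum>k=1..m. a k t)" for t
  define f where "f n t = S t * indicator {..real n} t" for n t
  have S: "S \<in> borel_measurable (lebesgue_on {0..})"
    unfolding S_def using meas by (intro measurable_compose[OF _ measurable_ennreal] borel_measurable_sum) auto
  have "(indicator {..real n} :: real \<Rightarrow> ennreal) \<in> borel_measurable (lebesgue_on {0..})" for n
    by (intro measurable_restrict_space1 borel_measurable_indicator) auto
  then have f_meas: "f n \<in> borel_measurable (lebesgue_on {0..})" for n
    unfolding f_def using S by (intro borel_measurable_times_ennreal) auto
  have f_inc: "incseq f"
    by (auto simp: f_def incseq_def le_fun_def indicator_def)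
  have f_sup: "(SUP n. f n t) = S t" for t
  proof (rule antisym)
    obtain n where "t \<le> real n" using real_arch_simple by blast
    then have "S t = f n t" by (simp add: f_def)
    then show "S t \<le> (SUP n. f n t)" by (metis SUP_upper UNIV_I)
  qed (auto intro!: SUP_least simp: f_def indicator_def)
  have f_int: "(\<integral>\<^sup>+t. f n t \<partial>lebesgue_on {0..}) = ennreal (A (real n))" for n
  proof -
    have "(\<integral>\<^sup>+t. f n t \<partial>lebesgue_on {0..}) = (\<integral>\<^sup>+t. f n t * indicator {0..} t \<partial>lebesgue)"
      by (rule nn_integral_restrict_space) simp
    also have "\<dots> = (\<integral>\<^sup>+t\<in>{0..real n}. S t \<partial>lebesgue)"
      by (intro nn_integral_cong) (auto simp: f_def indicator_def)
    finally show ?thesis using A_nn_integral[of "real n"] by (simp add: S_def)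
  qed
  have "\<infinity> = (\<integral>\<^sup>+t. S t \<partial>lebesgue_on {0..})"
    using inf by (simp add: nn_integral_restrict_space S_def)
  also have "\<dots> = (SUP n. ennreal (A (real n)))"
    using nn_integral_monotone_convergence_SUP[OF f_inc f_meas] by (simp add: f_sup f_int)
  finally have top: "(SUP n. ennreal (A (real n))) = top" by simp
  show ?thesis
    unfolding filterlim_at_top
  proof
    fix Z
    have "ennreal Z < (SUP n. ennreal (A (real n)))" unfolding top by simp
    then obtain n where "ennreal Z < ennreal (A (real n))" by (auto simp: less_SUP_iff)
    then have "Z \<le> A (real n)" by (meson ennreal_leI linorder_not_less nle_le)
    then show "\<forall>\<^sub>F t in at_top. Z \<le> A t"
      using A_mono[of "real n"] by (auto intro!: eventually_at_top_linorderI[of "real n"] elim: order_trans)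
  qed
qed

text \<open>Beyond some \<open>T\<close> each stretch of length \<open>R\<close> adds at least
  \<open>c\<close> to \<open>A\<close>, which gives \<alpha> as \<open>c / R\<close>. The constant
  \<beta> pays for the incomplete last stretch and for the time before \<open>T\<close>.\<close>

lemma A_linear_growth:
  assumes R: "0 < R" and liminf: "Liminf at_top (\<lambda>t. ereal (LINT \<tau>:{t..t+R}|lebesgue. (\<Sum>k=1..m. a k \<tau>))) > 0"
  obtains \<alpha> \<beta> where "0 < \<alpha>" "\<And>s t. \<lbrakk>0 \<le> s; s \<le> t\<rbrakk> \<Longrightarrow> \<alpha> * (t - s) - \<beta> \<le> A t - A s"
proof -
  obtain c where c: "0 < ereal c" "ereal c < Liminf at_top (\<lambda>t. ereal (LINT \<tau>:{t..t+R}|lebesgue. (\<Sum>k=1..m. a k \<tau>)))"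
    using ereal_dense2[OF liminf] by auto
  have "\<forall>\<^sub>F t in at_top. ereal c < ereal (LINT \<tau>:{t..t+R}|lebesgue. (\<Sum>k=1..m. a k \<tau>))"
    by (rule less_LiminfD[OF c(2)])
  then obtain T1 where T1: "\<And>t. T1 \<le> t \<Longrightarrow> c < (LINT \<tau>:{t..t+R}|lebesgue. (\<Sum>k=1..m. a k \<tau>))"
    by (auto simp: eventually_at_top_linorder)
  define T where "T = max T1 0"
  have T: "0 \<le> T" by (simp add: T_def)
  have block: "A t + c \<le> A (t + R)" if "T \<le> t" for t
    using T1[of t] A_set_lebesgue_integral[of t "t + R"] that R by (simp add: T_def)
  have blocks: "A s + real n * c \<le> A (s + real n * R)" if "T \<le> s" for s n
  proof (induction n)
    case (Suc n)
    have "A (s + real n * R) + c \<le> A (s + real n * R + R)" using that R by (intro block) (simp add: add_increasing2)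
    then show ?case using Suc by (simp add: algebra_simps)
  qed simp
  define \<alpha> where "\<alpha> = c / R"
  have \<alpha>: "0 < \<alpha>" using c R by (simp add: \<alpha>_def)
  have late: "\<alpha> * (t - s) - c \<le> A t - A s" if "T \<le> s" "s \<le> t" for s t
  proof -
    define n where "n = nat \<lfloor>(t - s) / R\<rfloor>"
    have "0 \<le> (t - s) / R" using that R by simp
    then have "real n = real_of_int \<lfloor>(t - s) / R\<rfloor>" by (simp add: n_def)
    then have n: "real n \<le> (t - s) / R" "(t - s) / R \<le> real n + 1" by linarith+
    have "s + real n * R \<le> t" using n(1) R by (simp add: field_simps)
    then have "A (s + real n * R) \<le> A t" using that T R by (intro A_mono) auto
    moreover have "c * ((t - s) / R) \<le> c * (real n + 1)" using n(2) c by (intro mult_left_mono) auto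
    ultimately show ?thesis using blocks[of s n] that by (simp add: \<alpha>_def algebra_simps)
  qed
  have "\<alpha> * (t - s) - (c + \<alpha> * T) \<le> A t - A s" if st: "0 \<le> s" "s \<le> t" for s t
  proof (cases "t \<le> T")
    case True
    then have "\<alpha> * (t - s) \<le> \<alpha> * T" using \<alpha> st by (intro mult_left_mono) auto
    then show ?thesis using A_mono[OF st] c by simp
  next
    case False
    have "\<alpha> * (t - max s T) - c \<le> A t - A (max s T)" using False st by (intro late) auto
    moreover have "A s \<le> A (max s T)" using st by (intro A_mono) auto
    moreover have "\<alpha> * (t - s) - \<alpha> * T \<le> \<alpha> * (t - max s T)"
      using \<alpha> st T by (simp flip: right_diff_distrib)
    ultimately show ?thesis by simp
  qed
  then show thesis using that \<alpha> by blast
qed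

text \<open>Once all delayed arguments are nonnegative, so is their minimum \<open>u\<close>, and
  the integral in the hypothesis is \<open>A t - A u\<close>. It dominates the
  \<open>A\<close>-length of every single delay.\<close>

lemma eventually_window:
  assumes m: "1 \<le> m"
    and h_lim: "\<And>k. k \<in> {1..m} \<Longrightarrow> filterlim (h k) at_top at_top"
    and limsup: "Limsup at_top (\<lambda>t. ereal
          (LINT s:{(MIN k\<in>{1..m}. h k t)..t}|lebesgue. (\<Sum>i=1..m. a i s))) < ereal r"
  obtains T where "0 \<le> T" "\<And>k t. \<lbrakk>k \<in> {1..m}; T \<le> t\<rbrakk> \<Longrightarrow> 0 \<le> h k t"
    "\<And>k t. \<lbrakk>k \<in> {1..m}; T \<le> t\<rbrakk> \<Longrightarrow> A t - A (h k t) \<le> r"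
proof -
  have "\<forall>\<^sub>F t in at_top. \<forall>k\<in>{1..m}. 0 \<le> h k t"
    using h_lim by (intro eventually_ball_finite) (auto simp: filterlim_at_top)
  moreover have "\<forall>\<^sub>F t in at_top. ereal
      (LINT s:{(MIN k\<in>{1..m}. h k t)..t}|lebesgue. (\<Sum>i=1..m. a i s)) < ereal r"
    by (rule Limsup_lessD[OF limsup])
  ultimately have "\<forall>\<^sub>F t in at_top. 0 \<le> t \<and> (\<forall>k\<in>{1..m}. 0 \<le> h k t) \<and>
      (LINT s:{(MIN k\<in>{1..m}. h k t)..t}|lebesgue. (\<Sum>i=1..m. a i s)) < r"
    using eventually_ge_at_top[of 0] by eventually_elim simp
  then obtain T where T: "\<And>t. T \<le> t \<Longrightarrow> 0 \<le> t \<and> (\<forall>k\<in>{1..m}. 0 \<le> h k t) \<and>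
      (LINT s:{(MIN k\<in>{1..m}. h k t)..t}|lebesgue. (\<Sum>i=1..m. a i s)) < r"
    by (auto simp: eventually_at_top_linorder)
  have "A t - A (h k t) \<le> r" if k: "k \<in> {1..m}" and t: "T \<le> t" for k t
  proof -
    define u where "u = (MIN k\<in>{1..m}. h k t)"
    have "u \<le> h k t" unfolding u_def using k by (intro Min_le) auto
    moreover have "u \<in> (\<lambda>k. h k t) ` {1..m}" unfolding u_def using m by (intro Min_in) auto
    ultimately have u: "0 \<le> u" "u \<le> h k t" "u \<le> t" using T[OF t] h_le[OF k, of t] by auto
    have "A t - A u < r" using T[OF t] A_set_lebesgue_integral[of u t] u by (simp add: u_def)
    then show ?thesis using A_mono[of u "h k t"] u by simp
  qed
  moreover have "0 \<le> T" using T[of T] by simp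
  ultimately show thesis using that T by blast
qed

end

section \<open>From uniform decay in \<open>A\<close> to stability and exponential estimates\<close>

theorem theorem2:
  fixes m :: nat and a h :: "nat \<Rightarrow> real \<Rightarrow> real"
  assumes m: "1 \<le> m"
    and a_meas: "\<And>k. k \<in> {1..m} \<Longrightarrow> a k \<in> borel_measurable (lebesgue_on {0..})"
    and a_ess_bounded: "\<And>k. k \<in> {1..m} \<Longrightarrow> \<exists>C. AE t in lebesgue_on {0..}. \<bar>a k t\<bar> \<le> C"
    and h_meas: "\<And>k. k \<in> {1..m} \<Longrightarrow> h k \<in> borel_measurable (lebesgue_on {0..})"
    and h_le: "\<And>k t. k \<in> {1..m} \<Longrightarrow> 0 \<le> t \<Longrightarrow> h k t \<le> t"
    and h_lim: "\<And>k. k \<in> {1..m} \<Longrightarrow> filterlim (h k) at_top at_top"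
    and a_nonneg: "\<And>k t. k \<in> {1..m} \<Longrightarrow> 0 \<le> t \<Longrightarrow> 0 \<le> a k t"
    and limsup_int: "Limsup at_top (\<lambda>t. ereal
          (LINT s:{(MIN k\<in>{1..m}. h k t)..t}|lebesgue. (\<Sum>i=1..m. a i s))) < ereal (1 + 1 / exp 1)"
    and int_infinite: "(\<integral>\<^sup>+t\<in>{0..}. ennreal (\<Sum>k=1..m. a k t) \<partial>lebesgue) = \<infinity>"
  shows "dde_asymptotically_stable m a h \<and>
    ((\<exists>R>0. Liminf at_top (\<lambda>t. ereal (LINT \<tau>:{t..t+R}|lebesgue. (\<Sum>k=1..m. a k \<tau>))) > 0) \<longrightarrow>
       (\<forall>X. fundamental_function m a h X \<longrightarrow> exponential_estimation X) \<and>
       ((\<forall>k\<in>{1..m}. Limsup at_top (\<lambda>t. ereal (t - h k t)) < \<infinity>) \<longrightarrow>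
          dde_exponentially_stable m a h))"
proof -
  interpret dde m a h
  proof
    show "(\<lambda>s. \<Sum>k=1..m. a k s) integrable_on {0..t}" for t
    proof (rule integrable_sum)
      fix k assume k: "k \<in> {1..m}"
      then obtain C where "AE t in lebesgue_on {0..}. \<bar>a k t\<bar> \<le> C" using a_ess_bounded by blast
      with a_meas[OF k] show "a k integrable_on {0..t}"
        by (rule ess_bounded_integrable_on) (rule a_nonneg[OF k])
    qed simp
  qed (use h_le a_nonneg in auto)
  have A_top: "filterlim A at_top at_top" using a_meas int_infinite by (rule A_at_top)
  define r :: real where "r = 1 + 1 / exp 1"
  have r: "1 \<le> r" "r < 11/8" using inverse_exp_1_less by (auto simp: r_def)
  obtain T where "0 \<le> T" "\<And>k t. \<lbrakk>k \<in> {1..m}; T \<le> t\<rbrakk> \<Longrightarrow> 0 \<le> h k t"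
    "\<And>k t. \<lbrakk>k \<in> {1..m}; T \<le> t\<rbrakk> \<Longrightarrow> A t - A (h k t) \<le> r"
    using eventually_window[OF m h_lim, of r] limsup_int unfolding r_def by blast
  from uniform_decay[OF A_top this(1) r this(2,3)]
  obtain C \<kappa> where C: "0 < C" and \<kappa>: "0 < \<kappa>" and decay:
    "\<And>t0 \<phi> x0 x B t. \<lbrakk>dde_solution m a h t0 \<phi> x0 x; 0 \<le> t0; 0 < B; \<And>y. y \<le> t0 \<Longrightarrow> \<bar>x y\<bar> \<le> B; t0 \<le> t\<rbrakk>
      \<Longrightarrow> \<bar>x t\<bar> \<le> C * B * exp (- \<kappa> * (A t - A t0))" by blast
  have sol_decay: "\<bar>x t\<bar> \<le> C * exp (- \<kappa> * (A t - A t0)) * (\<bar>x t0\<bar> + initial_sup t0 \<phi>)"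
    if "initial_function t0 \<phi>" "dde_solution m a h t0 \<phi> x0 x" "0 \<le> t0" "t0 \<le> t" for t0 t x0 \<phi> x
  proof -
    define E where "E = C * exp (- \<kappa> * (A t - A t0))"
    define B0 where "B0 = \<bar>x t0\<bar> + initial_sup t0 \<phi>"
    have E: "0 < E" using C by (simp add: E_def)
    have init: "\<bar>x y\<bar> \<le> B0" if "y \<le> t0" for y
      unfolding B0_def using initial_bound \<open>initial_function t0 \<phi>\<close> \<open>dde_solution m a h t0 \<phi> x0 x\<close> that .
    \<comment> \<open>\<open>decay\<close> asks for a positive bound, but \<open>B0\<close> vanishes
      for zero data; it is enlarged by \<open>e / E\<close>, and \<open>e\<close> is
      arbitrary.\<close>
    have "\<bar>x t\<bar> \<le> E * B0 + e" if e: "0 < e" for e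
    proof -
      have "0 \<le> B0" using init[of t0] by simp
      then have "0 < B0 + e / E" using E e by (simp add: add_nonneg_pos)
      moreover have "\<bar>x y\<bar> \<le> B0 + e / E" if "y \<le> t0" for y
        using init[OF that] E e by (simp add: add_increasing2)
      ultimately have "\<bar>x t\<bar> \<le> C * (B0 + e / E) * exp (- \<kappa> * (A t - A t0))"
        using \<open>dde_solution m a h t0 \<phi> x0 x\<close> \<open>0 \<le> t0\<close> \<open>t0 \<le> t\<close> by (intro decay)
      also have "\<dots> = E * (B0 + e / E)" by (simp add: E_def)
      also have "\<dots> = E * B0 + e" using E by (simp add: distrib_left)
      finally show ?thesis .
    qed
    then have "\<bar>x t\<bar> \<le> E * B0" by (rule field_le_epsilon)
    then show ?thesis by (simp add: E_def B0_def)
  qed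
  have "dde_stable m a h"
    unfolding dde_stable_def
  proof (intro allI impI)
    fix t0 \<epsilon> :: real assume t0: "0 \<le> t0" and \<epsilon>: "0 < \<epsilon>"
    show "\<exists>\<delta>>0. \<forall>\<phi> x0 x. initial_function t0 \<phi> \<longrightarrow> dde_solution m a h t0 \<phi> x0 x \<longrightarrow>
        initial_sup t0 \<phi> + \<bar>x t0\<bar> < \<delta> \<longrightarrow> (\<forall>t\<ge>t0. \<bar>x t\<bar> < \<epsilon>)"
    \<comment> \<open>\<open>A\<close> is nondecreasing, so the exponential factor is at most 1 and
      only \<open>C\<close> has to be compensated.\<close>
    proof (intro exI[of _ "\<epsilon> / C"] conjI allI impI)
      fix \<phi> x0 x t
      assume sol: "initial_function t0 \<phi>" "dde_solution m a h t0 \<phi> x0 x"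
        and small: "initial_sup t0 \<phi> + \<bar>x t0\<bar> < \<epsilon> / C" and t: "t0 \<le> t"
      have "0 \<le> \<kappa> * (A t - A t0)" using A_mono[OF t0 t] \<kappa> by simp
      then have "exp (- \<kappa> * (A t - A t0)) \<le> 1" by simp
      moreover have "0 \<le> \<bar>x t0\<bar> + initial_sup t0 \<phi>" using initial_bound[OF sol, of t0] by linarith
      ultimately have "C * exp (- \<kappa> * (A t - A t0)) * (\<bar>x t0\<bar> + initial_sup t0 \<phi>)
          \<le> C * 1 * (\<bar>x t0\<bar> + initial_sup t0 \<phi>)"
        using C by (intro mult_right_mono mult_left_mono) auto
      also have "\<dots> < \<epsilon>" using small C by (simp add: field_simps)
      finally show "\<bar>x t\<bar> < \<epsilon>" using sol_decay[OF sol t0 t] by simp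
    qed (use \<epsilon> C in auto)
  qed
  moreover have "(x \<longlongrightarrow> 0) at_top"
    if "0 \<le> t0" "initial_function t0 \<phi>" "dde_solution m a h t0 \<phi> x0 x" for t0 \<phi> x0 x
  proof (rule Lim_null_comparison)
    show "\<forall>\<^sub>F t in at_top. norm (x t) \<le> C * exp (- \<kappa> * (A t - A t0)) * (\<bar>x t0\<bar> + initial_sup t0 \<phi>)"
      using eventually_ge_at_top[of t0] by eventually_elim (use that sol_decay in auto)
    have "filterlim (\<lambda>t. - A t0 + A t) at_top at_top"
      by (rule filterlim_tendsto_add_at_top[OF tendsto_const A_top])
    then have "filterlim (\<lambda>t. \<kappa> * (- A t0 + A t)) at_top at_top"
      by (rule filterlim_tendsto_pos_mult_at_top[OF tendsto_const \<kappa>])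
    then have "filterlim (\<lambda>t. - (\<kappa> * (- A t0 + A t))) at_bot at_top"
      by (simp only: filterlim_uminus_at_bot minus_minus)
    then have "((\<lambda>t. exp (- (\<kappa> * (- A t0 + A t)))) \<longlongrightarrow> 0) at_top"
      by (rule filterlim_compose[OF exp_at_bot])
    then have "((\<lambda>t. exp (- \<kappa> * (A t - A t0))) \<longlongrightarrow> 0) at_top" by simp
    then show "((\<lambda>t. C * exp (- \<kappa> * (A t - A t0)) * (\<bar>x t0\<bar> + initial_sup t0 \<phi>)) \<longlongrightarrow> 0) at_top"
      by (intro tendsto_mult_left_zero tendsto_mult_right_zero)
  qed
  ultimately have asym: "dde_asymptotically_stable m a h"
    by (auto simp: dde_asymptotically_stable_def)
  have "(\<forall>X. fundamental_function m a h X \<longrightarrow> exponential_estimation X) \<and> dde_exponentially_stable m a h"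
    if R: "0 < R" "Liminf at_top (\<lambda>t. ereal (LINT \<tau>:{t..t+R}|lebesgue. (\<Sum>k=1..m. a k \<tau>))) > 0" for R
  proof -
    obtain \<alpha> \<beta> where \<alpha>: "0 < \<alpha>" and growth: "\<And>s t. \<lbrakk>0 \<le> s; s \<le> t\<rbrakk> \<Longrightarrow> \<alpha> * (t - s) - \<beta> \<le> A t - A s"
      using A_linear_growth[OF R] by blast
    \<comment> \<open>The extra factor absorbs the offset \<beta> in the linear growth of
      \<open>A\<close>.\<close>
    define D where "D = C * exp (\<kappa> * \<beta>)"
    have D: "0 < D" using C by (simp add: D_def)
    have exp_le: "C * exp (- \<kappa> * (A t - A s)) \<le> D * exp (- (\<kappa> * \<alpha>) * (t - s))" if "0 \<le> s" "s \<le> t" for s t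
    proof -
      have "\<kappa> * (\<alpha> * (t - s) - \<beta>) \<le> \<kappa> * (A t - A s)"
        using growth[OF that] \<kappa> by (intro mult_left_mono) auto
      then have "exp (- \<kappa> * (A t - A s)) \<le> exp (\<kappa> * \<beta> + - (\<kappa> * \<alpha>) * (t - s))"
        by (simp add: algebra_simps)
      then have "C * exp (- \<kappa> * (A t - A s)) \<le> C * exp (\<kappa> * \<beta> + - (\<kappa> * \<alpha>) * (t - s))"
        using C by (intro mult_left_mono) auto
      then show ?thesis by (simp only: D_def exp_add mult.assoc)
    qed
    have "exponential_estimation X" if X: "fundamental_function m a h X" for X
      unfolding exponential_estimation_def
    proof (rule exI[of _ D], rule conjI[OF D], rule exI[of _ "\<kappa> * \<alpha>"], intro conjI allI impI)
      fix s t :: real assume st: "0 \<le> s" "s \<le> t"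
      have sol: "dde_solution m a h s (\<lambda>_. 0) 1 (\<lambda>t. X t s)"
        using X st by (simp add: fundamental_function_def)
      \<comment> \<open>The history is 0 before \<open>s\<close> and 1 at \<open>s\<close>, so
        \<open>decay\<close> applies with \<open>B = 1\<close>.\<close>
      then have "\<bar>X y s\<bar> \<le> 1" if "y \<le> s" for y
        using that by (cases "y = s") (auto simp: dde_solution_def)
      then have "\<bar>X t s\<bar> \<le> C * 1 * exp (- \<kappa> * (A t - A s))"
        using st by (intro decay[OF sol]) auto
      then show "\<bar>X t s\<bar> \<le> D * exp (- (\<kappa> * \<alpha>) * (t - s))"
        using exp_le[OF st] by simp
    qed (use \<kappa> \<alpha> in auto)
    moreover have "dde_exponentially_stable m a h"
      unfolding dde_exponentially_stable_def
    proof (rule exI[of _ D], rule conjI[OF D], rule exI[of _ "\<kappa> * \<alpha>"], intro conjI allI impI)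
      fix t0 \<phi> x0 x t
      assume t: "0 \<le> t0" "t0 \<le> t" and sol: "initial_function t0 \<phi>" "dde_solution m a h t0 \<phi> x0 x"
      have "0 \<le> \<bar>x t0\<bar> + initial_sup t0 \<phi>" using initial_bound[OF sol, of t0] by linarith
      then show "\<bar>x t\<bar> \<le> D * exp (- (\<kappa> * \<alpha>) * (t - t0)) * (\<bar>x t0\<bar> + initial_sup t0 \<phi>)"
        using sol_decay[OF sol t] exp_le[OF t] by (meson mult_right_mono order_trans)
    qed (use \<kappa> \<alpha> in auto)
    ultimately show ?thesis by blast
  qed
  then show ?thesis using asym by blast
qed

end
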